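(* Let $M\ge 1$, let $Q(x)$ be a real polynomial of degree $M$ with $M$ real zeros, each of multiplicity $1$, and let $p\in\mathbb{R}$ with $Q(p)\ne 0$. Let $U=(U_{l,n})_{l,n\le M-2}$ be the inverse of the transition matrix $T=(T_{l,n})_{l,n\leq M-2}$ defined by $\psi_n(x)=\sum_l T_{l,n}(x-p)^l$, where the functions $\psi_n$ are as defined in the context; equivalently $(x-p)^n=\sum_l U_{l,n}\psi_l(x)$. Then for every integer $n<-1$, on every open interval not containing $p$ on which $Q>0$, $$\int (x-p)^n \frac{dx}{\sqrt{Q(x)}}=\sum_{l=-1}^{M-2}U_{l,n}I_{l,p}+2\sum_{l=n}^{-2} U_{l,n}\,(x-p)^{l+1}\sqrt{Q(x)}+C .$$
   Context: $I_{l,p}=\int \frac{(x-p)^l\,dx}{\sqrt{Q(x)}}$ denotes an antiderivative of $(x-p)^l/\sqrt{Q(x)}$ (on the interval considered), and $C$ is a constant of integration. The real numbers $b_j=b_j(p)$ are defined by $Q(x)=\sum_{j=0}^M b_j (x-p)^j$. Let $V$ be the real vector space spanned by the functions $f_n(x)=(x-p)^n$ for all integers $n<M-1$ (including all negative ones). The basis $(\psi_n)_{n\le M-2}$ of $V$ is defined by $$\psi_n(x)=\begin{cases}(x-p)^n & \text{for } -1\le n<M-1,\\ \sum_{l=n}^{n+M}(l+n+2)\,b_{l-n}\,(x-p)^l & \text{for } n<-1.\end{cases}$$ Rows and columns of $T$ and $U$ are indexed by the integers $\le M-2$ in decreasing order; with this ordering $T$ and $U$ are upper triangular. *)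

theory Defs
  imports "HOL-Analysis.Analysis" "HOL-Computational_Algebra.Computational_Algebra"
begin

definition shifted_coeff :: "real poly \<Rightarrow> real \<Rightarrow> nat \<Rightarrow> real" where
  "shifted_coeff Q p j = coeff (pcompose Q [:p, 1:]) j"

lemma poly_eq_shifted_sum:
  "poly Q x = (\<Sum>j\<le>degree Q. shifted_coeff Q p j * (x - p) ^ j)"
proof -
  have "degree (pcompose Q [:p, 1:]) = degree Q"
    by (simp add: degree_pcompose)
  then have "poly (pcompose Q [:p, 1:]) (x - p) = (\<Sum>j\<le>degree Q. shifted_coeff Q p j * (x - p) ^ j)"
    by (simp only: poly_altdef shifted_coeff_def)
  then show ?thesis
    by (simp add: poly_pcompose)
qed

text \<open>Only the indices \<open>n \<le> degree Q - 2\<close> are meaningful here; the functions live on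
  \<open>x \<noteq> p\<close> (recall that \<open>0 powi n = 0\<close> for negative \<open>n\<close>).\<close>

definition psi :: "real poly \<Rightarrow> real \<Rightarrow> int \<Rightarrow> real \<Rightarrow> real" where
  "psi Q p n x =
     (if n \<ge> -1 then (x - p) powi n
      else (\<Sum>l = n..n + int (degree Q).
              of_int (l + n + 2) * shifted_coeff Q p (nat (l - n)) * (x - p) powi l))"

text \<open>Matrices with rows and columns indexed by the integers \<open>\<le> N\<close> are functions
  \<open>int \<Rightarrow> int \<Rightarrow> real\<close> (row index first); entries outside the index range are ignored. Since the
  columns hold coordinates with respect to a basis, they must have finite support; inverses are
  taken among such matrices, where they are unique.\<close>

definition column_finite :: "int \<Rightarrow> (int \<Rightarrow> int \<Rightarrow> real) \<Rightarrow> bool" where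
  "column_finite N A \<longleftrightarrow> (\<forall>n\<le>N. finite {l. l \<le> N \<and> A l n \<noteq> 0})"

definition mat_mult :: "int \<Rightarrow> (int \<Rightarrow> int \<Rightarrow> real) \<Rightarrow> (int \<Rightarrow> int \<Rightarrow> real) \<Rightarrow> int \<Rightarrow> int \<Rightarrow> real" where
  "mat_mult N A B l n = (\<Sum>k | k \<le> N \<and> B k n \<noteq> 0. A l k * B k n)"

definition inverse_matrices :: "int \<Rightarrow> (int \<Rightarrow> int \<Rightarrow> real) \<Rightarrow> (int \<Rightarrow> int \<Rightarrow> real) \<Rightarrow> bool" where
  "inverse_matrices N A B \<longleftrightarrow>
     column_finite N A \<and> column_finite N B \<and>
     (\<forall>l\<le>N. \<forall>n\<le>N. mat_mult N A B l n = (if l = n then 1 else 0) \<and>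
                      mat_mult N B A l n = (if l = n then 1 else 0))"

definition transition_matrix :: "real poly \<Rightarrow> real \<Rightarrow> (int \<Rightarrow> int \<Rightarrow> real) \<Rightarrow> bool" where
  "transition_matrix Q p T \<longleftrightarrow>
     (let N = int (degree Q) - 2 in
        column_finite N T \<and>
        (\<forall>n\<le>N. \<forall>x. x \<noteq> p \<longrightarrow>
           psi Q p n x = (\<Sum>l | l \<le> N \<and> T l n \<noteq> 0. T l n * (x - p) powi l)))"

definition antiderivative_on :: "real set \<Rightarrow> (real \<Rightarrow> real) \<Rightarrow> (real \<Rightarrow> real) \<Rightarrow> bool" where
  "antiderivative_on S f F \<longleftrightarrow> (\<forall>x\<in>S. (F has_real_derivative f x) (at x))"

text \<open>Existence of \<open>T\<close> and \<open>U\<close>, so that hypotheses about them are never vacuous.\<close>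

function tri_inverse :: "int \<Rightarrow> (int \<Rightarrow> int \<Rightarrow> real) \<Rightarrow> int \<Rightarrow> int \<Rightarrow> real" where
  "tri_inverse N A k n =
     ((if k = n then 1 else 0) - (\<Sum>l\<in>{n<..N}. A l n * tri_inverse N A k l)) / A n n"
  by auto
termination by (relation "Wellfounded.measure (\<lambda>(N, A, k, n). nat (N - n))") auto

declare tri_inverse.simps [simp del]

lemma tri_inverse_below: "k < n \<Longrightarrow> tri_inverse N A k n = 0"
proof (induction "nat (N - n)" arbitrary: n rule: less_induct)
  case less
  have "tri_inverse N A k l = 0" if "l \<in> {n<..N}" for l
    using less.hyps [of l] less.prems that by auto
  then show ?case
    using less.prems by (simp add: tri_inverse.simps [of N A k n])
qed

lemma tri_inverse_diag: "tri_inverse N A n n = 1 / A n n"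
  by (simp add: tri_inverse.simps [of N A n n] tri_inverse_below)

lemma mat_mult_upper:
  assumes "\<And>k. k < n \<Longrightarrow> B k n = 0"
  shows "mat_mult N A B l n = (\<Sum>k\<in>{n..N}. A l k * B k n)"
  unfolding mat_mult_def
  by (rule sum.mono_neutral_left) (use assms in \<open>auto simp: not_less [symmetric]\<close>)

lemma column_finite_upper:
  assumes "\<And>k n. k < n \<Longrightarrow> n \<le> N \<Longrightarrow> B k n = 0"
  shows "column_finite N B"
  unfolding column_finite_def
proof (intro allI impI)
  fix n assume "n \<le> N"
  then have "{l. l \<le> N \<and> B l n \<noteq> 0} \<subseteq> {n..N}"
    using assms by (auto simp: not_less [symmetric])
  then show "finite {l. l \<le> N \<and> B l n \<noteq> 0}"
    by (rule finite_subset) simp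
qed

lemma tri_inverse_left:
  assumes "A n n \<noteq> 0" "n \<le> N"
  shows "(\<Sum>k\<in>{n..N}. tri_inverse N A l k * A k n) = (if l = n then 1 else 0)"
proof -
  have "{n..N} = insert n {n<..N}"
    using assms(2) by auto
  then have "(\<Sum>k\<in>{n..N}. tri_inverse N A l k * A k n)
      = tri_inverse N A l n * A n n + (\<Sum>k\<in>{n<..N}. A k n * tri_inverse N A l k)"
    by (simp add: mult.commute)
  then show ?thesis
    using assms(1) by (simp add: tri_inverse.simps [of N A l n])
qed

lemma sum_from_upper:
  fixes f :: "int \<Rightarrow> real"
  assumes "m \<le> n" "\<And>k. m \<le> k \<Longrightarrow> k < n \<Longrightarrow> f k = 0"
  shows "(\<Sum>k\<in>{n..N}. f k) = (\<Sum>k\<in>{m..N}. f k)"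
  by (rule sum.mono_neutral_left) (use assms in auto)

lemma inverse_matrices_tri_inverse:
  assumes up: "\<And>k n. k < n \<Longrightarrow> n \<le> N \<Longrightarrow> A k n = 0" and diag: "\<And>n. n \<le> N \<Longrightarrow> A n n \<noteq> 0"
  shows "inverse_matrices N A (tri_inverse N A)"
proof -
  let ?B = "tri_inverse N A"
  let ?W = "tri_inverse N ?B"
  have upB: "k < n \<Longrightarrow> ?B k n = 0" and upW: "k < n \<Longrightarrow> ?W k n = 0" for k n
    by (auto intro: tri_inverse_below)
  have diagB: "n \<le> N \<Longrightarrow> ?B n n \<noteq> 0" for n
    using diag by (simp add: tri_inverse_diag)
  have BA: "(\<Sum>k\<in>{m..N}. ?B l k * A k n) = (if l = n then 1 else 0)" if "m \<le> n" "n \<le> N" for l m n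
    using tri_inverse_left [of A n N l, OF diag [OF that(2)] that(2)] sum_from_upper [of m n "\<lambda>k. ?B l k * A k n" N] up that
    by simp
  have WB: "(\<Sum>k\<in>{m..N}. ?W l k * ?B k n) = (if l = n then 1 else 0)" if "m \<le> n" "n \<le> N" for l m n
    using tri_inverse_left [of ?B n N l, OF diagB [OF that(2)] that(2)]
      sum_from_upper [of m n "\<lambda>k. ?W l k * ?B k n" N] upB that
    by simp
  have W: "?W l n = A l n" if "l \<le> N" "n \<le> N" for l n
  proof -
    let ?m = "min l n"
    have "?W l n = (\<Sum>j\<in>{?m..N}. ?W l j * (if j = n then 1 else 0))"
      using that by (subst sum.cong [OF refl, of _ _ "\<lambda>j. if j = n then ?W l j else 0"]) auto
    also have "\<dots> = (\<Sum>j\<in>{?m..N}. ?W l j * (\<Sum>k\<in>{?m..N}. ?B j k * A k n))"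
      by (intro sum.cong refl) (use that in \<open>simp add: BA\<close>)
    also have "\<dots> = (\<Sum>k\<in>{?m..N}. (\<Sum>j\<in>{?m..N}. ?W l j * ?B j k) * A k n)"
      by (simp add: sum_distrib_left sum_distrib_right mult.assoc) (rule sum.swap)
    also have "\<dots> = (\<Sum>k\<in>{?m..N}. (if l = k then 1 else 0) * A k n)"
      by (intro sum.cong refl arg_cong2 [where f = "(*)"]) (use WB in auto)
    also have "\<dots> = A l n"
      using that by (subst sum.cong [OF refl, of _ _ "\<lambda>k. if l = k then A k n else 0"]) auto
    finally show ?thesis .
  qed
  have "mat_mult N A ?B l n = (if l = n then 1 else 0)" if "l \<le> N" "n \<le> N" for l n
  proof -
    have "mat_mult N A ?B l n = (\<Sum>k\<in>{n..N}. A l k * ?B k n)"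
      by (rule mat_mult_upper) (rule upB)
    also have "\<dots> = (\<Sum>k\<in>{n..N}. ?W l k * ?B k n)"
      by (intro sum.cong refl) (use W that in auto)
    finally show ?thesis
      using WB that by simp
  qed
  moreover have "mat_mult N ?B A l n = (if l = n then 1 else 0)" if "n \<le> N" for l n
    using mat_mult_upper [of n A N ?B l] up BA that by simp
  moreover have "column_finite N A" "column_finite N ?B"
    using up upB by (auto intro!: column_finite_upper)
  ultimately show ?thesis
    by (simp add: inverse_matrices_def)
qed

lemma transition_matrix_inverse_exists:
  assumes "degree Q \<ge> 1" "poly Q p \<noteq> 0"
  shows "\<exists>T U. transition_matrix Q p T \<and> inverse_matrices (int (degree Q) - 2) T U"
proof -
  define N where "N = int (degree Q) - 2"
  define T :: "int \<Rightarrow> int \<Rightarrow> real" where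
    "T l n = (if n \<ge> -1 then if l = n then 1 else 0
              else if l \<in> {n..n + int (degree Q)}
              then of_int (l + n + 2) * shifted_coeff Q p (nat (l - n)) else 0)" for l n
  have up: "T k n = 0" if "k < n" for k n
    using that by (auto simp: T_def)
  have "shifted_coeff Q p 0 = poly Q p"
    by (simp add: shifted_coeff_def coeff_pcompose_0)
  then have diag: "T n n \<noteq> 0" for n
    using assms by (auto simp: T_def)
  have "psi Q p n x = (\<Sum>l | l \<le> N \<and> T l n \<noteq> 0. T l n * (x - p) powi l)" if "n \<le> N" for n x
  proof (cases "n \<ge> -1")
    case True
    then have "{l. l \<le> N \<and> T l n \<noteq> 0} = {n}"
      using that by (auto simp: T_def split: if_splits)
    with True show ?thesis
      by (simp add: psi_def T_def)
  next
    case False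
    have "(\<Sum>l | l \<le> N \<and> T l n \<noteq> 0. T l n * (x - p) powi l)
        = (\<Sum>l = n..n + int (degree Q). T l n * (x - p) powi l)"
      by (rule sum.mono_neutral_left) (use False that in \<open>auto simp: T_def N_def split: if_splits\<close>)
    also have "\<dots> = psi Q p n x"
      using False by (auto simp: psi_def T_def intro!: sum.cong)
    finally show ?thesis ..
  qed
  moreover have "column_finite N T"
    by (rule column_finite_upper) (rule up)
  ultimately have "transition_matrix Q p T"
    by (simp add: transition_matrix_def N_def)
  moreover have "inverse_matrices N T (tri_inverse N T)"
    by (rule inverse_matrices_tri_inverse) (use up diag in auto)
  ultimately show ?thesis
    unfolding N_def by blast
qed

end

theory Submission
  imports Defs
begin

text \<open>
  For \<open>l < -1\<close> the function \<open>psi Q p l\<close> is exactly the numerator that appears when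
  \<open>2 (x - p)\<^bsup>l+1\<^esup> \<surd>Q\<close> is differentiated:
  the derivative is \<open>(2 (l + 1) (x - p)\<^bsup>l\<^esup> Q + (x - p)\<^bsup>l+1\<^esup> Q') / \<surd>Q\<close>, and inserting
  \<open>Q = \<Sum> b\<^sub>j (x - p)\<^sup>j\<close> gives the factor \<open>2 l + 2 + j\<close> in front of \<open>b\<^sub>j (x - p)\<^bsup>l+j\<^esup>\<close>
  (lemma \<open>psi_antiderivative\<close>). So every \<open>psi Q p l / \<surd>Q\<close> has an explicit
  antiderivative, apart from the finitely many \<open>l \<ge> -1\<close>, which contribute the integrals \<open>I l\<close>.
  It remains to integrate the expansion \<open>(x - p)\<^sup>n = \<Sum> U\<^sub>l\<^sub>n psi\<^sub>l(x)\<close>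
  term by term (lemma \<open>power_expansion\<close>), and to recall that antiderivatives on an interval are
  unique up to a constant.

  The expansion runs over \<open>n \<le> l \<le> M - 2\<close> only because \<open>U\<close> is upper triangular. This has to be
  derived: \<open>T\<close> is given just by the functional identity for \<open>psi\<close>, so its entries are first
  identified by uniqueness of Laurent coefficients (lemma \<open>laurent_coeffs_zero\<close>). They are upper
  triangular with diagonal entries \<open>1\<close> or \<open>(2 n + 2) Q(p)\<close>, which do not vanish, and the
  lowest nonzero entry in a column of a right inverse of such a matrix cannot lie below the
  diagonal (lemma \<open>right_inverse_upper\<close>).
\<close>

section \<open>Finite Laurent sums\<close>

text \<open>After multiplication by a suitable power of \<open>x - p\<close> the sum becomes a polynomial with
  infinitely many zeros.\<close>

lemma laurent_coeffs_zero:
  fixes c :: "int \<Rightarrow> real"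
  assumes fin: "finite L"
    and zero: "\<And>x. x \<noteq> p \<Longrightarrow> (\<Sum>l\<in>L. c l * (x - p) powi l) = 0"
    and k: "k \<in> L"
  shows "c k = 0"
proof -
  define m where "m = Min L"
  have m: "m \<le> l" if "l \<in> L" for l
    using that fin by (simp add: m_def)
  define P where "P = (\<Sum>l\<in>L. monom (c l) (nat (l - m)))"
  have "poly P y = 0" if "y \<noteq> 0" for y
  proof -
    have "poly P y = (\<Sum>l\<in>L. c l * y ^ nat (l - m))"
      by (simp add: P_def poly_sum poly_monom)
    also have "\<dots> = (\<Sum>l\<in>L. y powi (- m) * (c l * y powi l))"
    proof (rule sum.cong [OF refl])
      fix l assume "l \<in> L"
      then have "y ^ nat (l - m) = y powi (- m + l)"
        using m by (simp add: power_int_def)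
      also have "\<dots> = y powi (- m) * y powi l"
        using that by (intro power_int_add) auto
      finally show "c l * y ^ nat (l - m) = y powi (- m) * (c l * y powi l)"
        by simp
    qed
    also have "\<dots> = 0"
      using zero [of "p + y"] that by (simp add: sum_distrib_left [symmetric])
    finally show ?thesis .
  qed
  then have "UNIV - {0} \<subseteq> {y. poly P y = 0}"
    by auto
  moreover have "infinite (UNIV - {0 :: real})"
    by (simp add: infinite_UNIV_char_0)
  ultimately have "P = 0"
    using finite_subset poly_roots_finite by blast
  then have "0 = coeff P (nat (k - m))"
    by simp
  also have "\<dots> = (\<Sum>l\<in>L. if l = k then c l else 0)"
    unfolding P_def coeff_sum using m k by (intro sum.cong) (auto simp: eq_nat_nat_iff)
  also have "\<dots> = c k"
    using fin k by simp
  finally show ?thesis ..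
qed

section \<open>The transition matrix and its inverse\<close>

definition psi_coeff :: "real poly \<Rightarrow> real \<Rightarrow> int \<Rightarrow> int \<Rightarrow> real" where
  "psi_coeff Q p l n =
     (if n \<ge> -1 then if l = n then 1 else 0
      else if l \<in> {n..n + int (degree Q)}
      then of_int (l + n + 2) * shifted_coeff Q p (nat (l - n)) else 0)"

lemma psi_coeff_below: "l < n \<Longrightarrow> psi_coeff Q p l n = 0"
  by (simp add: psi_coeff_def)

lemma psi_coeff_diag: "poly Q p \<noteq> 0 \<Longrightarrow> psi_coeff Q p n n \<noteq> 0"
  by (auto simp: psi_coeff_def shifted_coeff_def coeff_pcompose_0)

lemma psi_eq_sum_psi_coeff:
  assumes "finite L" "{l. l \<le> int (degree Q) - 2 \<and> psi_coeff Q p l n \<noteq> 0} \<subseteq> L"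
    and "n \<le> int (degree Q) - 2"
  shows "psi Q p n x = (\<Sum>l\<in>L. psi_coeff Q p l n * (x - p) powi l)"
proof (cases "n \<ge> -1")
  case True
  then have "n \<in> L"
    using assms(2,3) by (auto simp: psi_coeff_def)
  moreover have "(\<Sum>l\<in>L. psi_coeff Q p l n * (x - p) powi l) = (\<Sum>l\<in>L. if l = n then (x - p) powi n else 0)"
    using True by (intro sum.cong) (auto simp: psi_coeff_def)
  ultimately show ?thesis
    using True assms(1) by (simp add: psi_def)
next
  case False
  have "psi Q p n x = (\<Sum>l = n..n + int (degree Q). psi_coeff Q p l n * (x - p) powi l)"
    using False by (auto simp: psi_def psi_coeff_def intro!: sum.cong)
  also have "\<dots> = (\<Sum>l\<in>L. psi_coeff Q p l n * (x - p) powi l)"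
  proof (rule sum.mono_neutral_cong [OF assms(1)])
    fix l assume l: "l \<in> {n..n + int (degree Q)} - L"
    then have "l \<le> int (degree Q) - 2"
      using False by simp
    then show "psi_coeff Q p l n * (x - p) powi l = 0"
      using l assms(2) by auto
  qed (use False in \<open>auto simp: psi_coeff_def\<close>)
  finally show ?thesis .
qed

lemma transition_matrix_eq_psi_coeff:
  assumes T: "transition_matrix Q p T"
    and "l \<le> int (degree Q) - 2" "n \<le> int (degree Q) - 2"
  shows "T l n = psi_coeff Q p l n"
proof -
  let ?N = "int (degree Q) - 2"
  let ?A = "{l. l \<le> ?N \<and> T l n \<noteq> 0}"
  let ?L = "?A \<union> {l} \<union> {n..?N}"
  have fin: "finite ?A"
    using T assms(3) by (simp add: transition_matrix_def column_finite_def Let_def)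
  have sub: "{l. l \<le> ?N \<and> psi_coeff Q p l n \<noteq> 0} \<subseteq> ?L"
    using psi_coeff_below [of _ n Q p] by (auto simp: not_less [symmetric])
  have "(\<Sum>k\<in>?L. (T k n - psi_coeff Q p k n) * (x - p) powi k) = 0" if "x \<noteq> p" for x
  proof -
    have "psi Q p n x = (\<Sum>k\<in>?A. T k n * (x - p) powi k)"
      using T assms(3) that by (simp add: transition_matrix_def Let_def)
    also have "\<dots> = (\<Sum>k\<in>?L. T k n * (x - p) powi k)"
      using fin assms(2) by (intro sum.mono_neutral_left) auto
    moreover have "psi Q p n x = (\<Sum>k\<in>?L. psi_coeff Q p k n * (x - p) powi k)"
      using fin sub assms(3) by (intro psi_eq_sum_psi_coeff) auto
    ultimately show ?thesis
      by (simp add: left_diff_distrib sum_subtractf)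
  qed
  from laurent_coeffs_zero [OF _ this, of l] fin show ?thesis
    by simp
qed

text \<open>At the lowest row \<open>k\<close> with \<open>B k n \<noteq> 0\<close>, only the diagonal term survives in the product
  \<open>(AB)\<^sub>k\<^sub>n\<close>, so that this entry is nonzero; hence \<open>k = n\<close>. Such a row exists because the column is
  finite.\<close>

lemma right_inverse_upper:
  assumes up: "\<And>k n. k < n \<Longrightarrow> n \<le> N \<Longrightarrow> A k n = 0"
    and diag: "\<And>n. n \<le> N \<Longrightarrow> A n n \<noteq> 0"
    and inv: "inverse_matrices N A B"
    and "l < n" "n \<le> N"
  shows "B l n = 0"
proof (rule ccontr)
  assume "B l n \<noteq> 0"
  let ?K = "{k. k \<le> N \<and> B k n \<noteq> 0}"
  define m where "m = Min ?K"
  have fin: "finite ?K"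
    using inv assms(5) by (simp add: inverse_matrices_def column_finite_def)
  have "l \<in> ?K"
    using \<open>B l n \<noteq> 0\<close> assms(4,5) by simp
  then have m: "m \<in> ?K" "m \<le> l"
    unfolding m_def using Min_in [OF fin] Min_le [OF fin] by blast+
  have "A m k * B k n = 0" if "k \<in> ?K - {m}" for k
    using up [of m k] that Min_le [OF fin, of k] by (auto simp: m_def [symmetric])
  then have "mat_mult N A B m n = A m m * B m n"
    unfolding mat_mult_def using fin m(1) by (subst sum.remove [of _ m]) auto
  then have "mat_mult N A B m n \<noteq> 0"
    using m diag by simp
  moreover have "mat_mult N A B m n = 0"
    using inv m assms(4,5) by (simp add: inverse_matrices_def)
  ultimately show False
    by simp
qed

lemma power_expansion:
  assumes T: "transition_matrix Q p T"
    and inv: "inverse_matrices (int (degree Q) - 2) T U"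
    and Qp: "poly Q p \<noteq> 0" and n: "n \<le> int (degree Q) - 2" and x: "x \<noteq> p"
  shows "(x - p) powi n = (\<Sum>l = n..int (degree Q) - 2. U l n * psi Q p l x)"
proof -
  define N where "N = int (degree Q) - 2"
  let ?t = "psi_coeff Q p"
  have TN: "T l k = ?t l k" if "l \<le> N" "k \<le> N" for l k
    using transition_matrix_eq_psi_coeff [OF T] that by (simp add: N_def)
  have U0: "U l n = 0" if "l < n" for l
    by (rule right_inverse_upper [of N T U])
      (use TN inv n that psi_coeff_below psi_coeff_diag [OF Qp] in \<open>auto simp: N_def\<close>)
  have "(\<Sum>k = n..N. U k n * psi Q p k x)
      = (\<Sum>k = n..N. U k n * (\<Sum>l = n..N. ?t l k * (x - p) powi l))"
  proof (rule sum.cong [OF refl])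
    fix k assume k: "k \<in> {n..N}"
    have "psi Q p k x = (\<Sum>l = n..N. ?t l k * (x - p) powi l)"
    proof (rule psi_eq_sum_psi_coeff)
      show "{l. l \<le> int (degree Q) - 2 \<and> ?t l k \<noteq> 0} \<subseteq> {n..N}"
        using psi_coeff_below [of _ k Q p] k by (force simp: N_def not_less [symmetric])
    qed (use k in \<open>auto simp: N_def\<close>)
    then show "U k n * psi Q p k x = U k n * (\<Sum>l = n..N. ?t l k * (x - p) powi l)"
      by simp
  qed
  also have "\<dots> = (\<Sum>l = n..N. (\<Sum>k = n..N. ?t l k * U k n) * (x - p) powi l)"
    by (simp add: sum_distrib_left sum_distrib_right mult_ac) (rule sum.swap)
  also have "\<dots> = (\<Sum>l = n..N. mat_mult N T U l n * (x - p) powi l)"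
    using TN U0 by (auto intro!: sum.cong simp: mat_mult_upper)
  also have "\<dots> = (\<Sum>l = n..N. if l = n then (x - p) powi n else 0)"
    using inv n by (intro sum.cong) (auto simp: inverse_matrices_def N_def)
  also have "\<dots> = (x - p) powi n"
    using n by (simp add: N_def)
  finally show ?thesis
    by (simp add: N_def)
qed

section \<open>Antiderivatives\<close>

lemma psi_eq_poly_pderiv:
  assumes "n < -1" "x \<noteq> p"
  shows "psi Q p n x
    = 2 * of_int (n + 1) * (x - p) powi n * poly Q x + (x - p) powi (n + 1) * poly (pderiv Q) x"
proof -
  let ?b = "shifted_coeff Q p" and ?y = "x - p"
  have "(poly Q has_real_derivative (\<Sum>j\<le>degree Q. ?b j * (real j * ?y ^ (j - 1)))) (at x)"
    unfolding poly_eq_shifted_sum [of Q _ p, abs_def]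
    by (auto intro!: derivative_eq_intros sum.cong)
  then have Q': "poly (pderiv Q) x = (\<Sum>j\<le>degree Q. ?b j * (real j * ?y ^ (j - 1)))"
    by (rule DERIV_unique [OF poly_DERIV])
  have pw: "?y powi (n + int j) = ?y powi n * ?y ^ j" for j
    using assms(2) by (simp add: power_int_add)
  have "psi Q p n x = (\<Sum>j\<le>degree Q. of_int (2 * n + 2 + int j) * ?b j * (?y powi n * ?y ^ j))"
    unfolding psi_def using assms(1)
    by (simp, intro sum.reindex_bij_witness [of _ "\<lambda>j. n + int j" "\<lambda>l. nat (l - n)"])
      (auto simp: pw [symmetric] algebra_simps)
  also have "\<dots> = (\<Sum>j\<le>degree Q. 2 * of_int (n + 1) * ?y powi n * (?b j * ?y ^ j)
      + ?y powi (n + 1) * (?b j * (real j * ?y ^ (j - 1))))"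
  proof (rule sum.cong [OF refl])
    fix j
    have "?y powi (n + 1) * (real j * ?y ^ (j - 1)) = real j * (?y powi n * ?y ^ j)"
      using assms(2) by (cases j) (simp_all add: power_int_add)
    then have eq: "?y powi (n + 1) * (?b j * (real j * ?y ^ (j - 1))) = ?b j * (real j * (?y powi n * ?y ^ j))"
      by (simp only: mult.left_commute [of _ "?b j"])
    show "of_int (2 * n + 2 + int j) * ?b j * (?y powi n * ?y ^ j)
        = 2 * of_int (n + 1) * ?y powi n * (?b j * ?y ^ j)
          + ?y powi (n + 1) * (?b j * (real j * ?y ^ (j - 1)))"
      unfolding eq by (simp add: algebra_simps)
  qed
  also have "\<dots> = 2 * of_int (n + 1) * ?y powi n * poly Q x + ?y powi (n + 1) * poly (pderiv Q) x"
    by (simp add: sum.distrib sum_distrib_left Q' poly_eq_shifted_sum [of Q x p])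
  finally show ?thesis .
qed

lemma psi_antiderivative:
  assumes "n < -1" "x \<noteq> p" "poly Q x > 0"
  shows "((\<lambda>x. 2 * ((x - p) powi (n + 1) * sqrt (poly Q x)))
    has_real_derivative psi Q p n x / sqrt (poly Q x)) (at x)"
proof -
  define s where "s = sqrt (poly Q x)"
  have s: "s > 0" "poly Q x = s * s"
    using assms(3) by (simp_all add: s_def)
  have "((\<lambda>x. (x - p) powi (n + 1)) has_real_derivative of_int (n + 1) * (x - p) powi n) (at x)"
    using assms(2) by (auto intro!: derivative_eq_intros)
  moreover have "((\<lambda>x. sqrt (poly Q x)) has_real_derivative poly (pderiv Q) x / (2 * s)) (at x)"
    using assms(3) by (auto intro!: derivative_eq_intros simp: s_def divide_simps)
  ultimately have "((\<lambda>x. 2 * ((x - p) powi (n + 1) * sqrt (poly Q x))) has_real_derivative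
      2 * (of_int (n + 1) * (x - p) powi n * s
        + poly (pderiv Q) x / (2 * s) * (x - p) powi (n + 1))) (at x)"
    unfolding s_def by (intro DERIV_cmult DERIV_mult)
  moreover have "2 * (of_int (n + 1) * (x - p) powi n * s
        + poly (pderiv Q) x / (2 * s) * (x - p) powi (n + 1)) = psi Q p n x / s"
    using s(1) psi_eq_poly_pderiv [OF assms(1,2), of Q] by (simp add: s(2) field_simps)
  ultimately show ?thesis
    by (simp add: s_def)
qed

lemma antiderivative_on_iff_eq_up_to_const:
  assumes G: "antiderivative_on S f G" and "open S" "is_interval S"
  shows "antiderivative_on S f F \<longleftrightarrow> (\<exists>C. \<forall>x\<in>S. F x = G x + C)"
proof
  assume F: "antiderivative_on S f F"
  have "\<exists>C. \<forall>x\<in>S. F x - G x = C"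
  proof (rule has_field_derivative_zero_constant)
    show "convex S"
      using assms(3) by (rule is_interval_convex)
    show "((\<lambda>x. F x - G x) has_real_derivative 0) (at x within S)" if "x \<in> S" for x
      using F G that unfolding antiderivative_on_def
      by (metis DERIV_diff diff_self has_field_derivative_at_within)
  qed
  then show "\<exists>C. \<forall>x\<in>S. F x = G x + C"
    by (metis add.commute diff_add_cancel)
next
  assume "\<exists>C. \<forall>x\<in>S. F x = G x + C"
  then obtain C where C: "\<And>x. x \<in> S \<Longrightarrow> F x = G x + C"
    by blast
  show "antiderivative_on S f F"
    unfolding antiderivative_on_def
  proof
    fix x assume "x \<in> S"
    then have "((\<lambda>x. G x + C) has_real_derivative f x) (at x)"
      using G by (auto simp: antiderivative_on_def intro!: derivative_eq_intros)
    then show "(F has_real_derivative f x) (at x)"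
      by (rule has_field_derivative_transform_within_open [OF _ assms(2) \<open>x \<in> S\<close>]) (simp add: C)
  qed
qed

theorem mainTheorem2:
  fixes Q :: "real poly" and p :: real and M :: nat
    and T U :: "int \<Rightarrow> int \<Rightarrow> real" and n :: int
    and S :: "real set" and I :: "int \<Rightarrow> real \<Rightarrow> real" and F :: "real \<Rightarrow> real"
  assumes "M \<ge> 1"
    and "degree Q = M"
    and "card {x. poly Q x = 0} = M"
    and "\<forall>x. poly Q x = 0 \<longrightarrow> order x Q = 1"
    and "poly Q p \<noteq> 0"
    and "transition_matrix Q p T"
    and "inverse_matrices (int M - 2) T U"
    and "n < -1"
    and "open S" and "is_interval S"
    and "p \<notin> S"
    and "\<forall>x\<in>S. poly Q x > 0"
    and "\<forall>l\<in>{-1..int M - 2}.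
           antiderivative_on S (\<lambda>x. (x - p) powi l / sqrt (poly Q x)) (I l)"
  shows "antiderivative_on S (\<lambda>x. (x - p) powi n / sqrt (poly Q x)) F \<longleftrightarrow>
         (\<exists>C. \<forall>x\<in>S. F x = (\<Sum>l = -1..int M - 2. U l n * I l x)
              + 2 * (\<Sum>l = n..-2. U l n * (x - p) powi (l + 1) * sqrt (poly Q x)) + C)"
proof -
  let ?N = "int M - 2" and ?s = "\<lambda>x. sqrt (poly Q x)"
  define G where "G x = (\<Sum>l = -1..?N. U l n * I l x)
      + 2 * (\<Sum>l = n..-2. U l n * (x - p) powi (l + 1) * ?s x)" for x
  have "antiderivative_on S (\<lambda>x. (x - p) powi n / ?s x) G"
    unfolding antiderivative_on_def
  proof
    fix x assume "x \<in> S"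
    then have x: "x \<noteq> p" "poly Q x > 0"
      using assms(11,12) by auto
    have "((\<lambda>x. (\<Sum>l = -1..?N. U l n * I l x)
          + (\<Sum>l = n..-2. U l n * (2 * ((x - p) powi (l + 1) * ?s x))))
        has_real_derivative
          (\<Sum>l = -1..?N. U l n * (psi Q p l x / ?s x))
          + (\<Sum>l = n..-2. U l n * (psi Q p l x / ?s x))) (at x)"
    proof (intro DERIV_add DERIV_sum DERIV_cmult)
      show "(I l has_real_derivative psi Q p l x / ?s x) (at x)" if "l \<in> {-1..?N}" for l
        using assms(13) that \<open>x \<in> S\<close> by (simp add: antiderivative_on_def psi_def)
      show "((\<lambda>x. 2 * ((x - p) powi (l + 1) * ?s x)) has_real_derivative psi Q p l x / ?s x) (at x)"
        if "l \<in> {n..-2}" for l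
        using psi_antiderivative [of l x p Q] x that by simp
    qed
    moreover have "(\<Sum>l = n..-2. U l n * (2 * ((x - p) powi (l + 1) * ?s x)))
        = 2 * (\<Sum>l = n..-2. U l n * (x - p) powi (l + 1) * ?s x)" for x
      by (simp add: sum_distrib_left mult_ac)
    moreover have "(\<Sum>l = -1..?N. U l n * (psi Q p l x / ?s x))
        + (\<Sum>l = n..-2. U l n * (psi Q p l x / ?s x)) = (x - p) powi n / ?s x"
    proof -
      have split: "{n..?N} = {-1..?N} \<union> {n..-2}"
        using assms(1,8) by auto
      have "(x - p) powi n = (\<Sum>l = n..?N. U l n * psi Q p l x)"
        using power_expansion [of Q p T U n x] assms x by simp
      then have "(x - p) powi n / ?s x = (\<Sum>l = n..?N. U l n * (psi Q p l x / ?s x))"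
        by (simp add: sum_divide_distrib)
      also have "\<dots> = (\<Sum>l = -1..?N. U l n * (psi Q p l x / ?s x))
        + (\<Sum>l = n..-2. U l n * (psi Q p l x / ?s x))"
        unfolding split by (rule sum.union_disjoint) auto
      finally show ?thesis ..
    qed
    ultimately show "(G has_real_derivative (x - p) powi n / ?s x) (at x)"
      unfolding G_def [abs_def] by simp
  qed
  from antiderivative_on_iff_eq_up_to_const [OF this assms(9,10)] show ?thesis
    by (simp add: G_def)
qed

end
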